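(* Let $R$ be a Noetherian integral domain. Then: (i) $R$ satisfies the property (P) if and only if $I^* = I$ for all nonzero ideals $I$ of $R$. (ii) If every ideal in $R$ is integrally closed, then $R$ satisfies the property (P).
   Context: All rings are commutative with identity $1\neq 0$. A ring $R$ satisfies the property (P) if whenever $I \subsetneq J$ are ideals of $R$, one has $I^n \subsetneq J^n$ for all $n \geq 1$. For an ideal $I$ in a Noetherian ring $R$, $I^* = \bigcup_{m\geq 1} (I^{m+1} : I^m)$, where $(A:B)=\{r\in R : rB\subseteq A\}$. (A regular ideal $I$, i.e. one containing a nonzerodivisor, with $I=I^*$ is called a Ratliff-Rush ideal.) *)

theory Defs
  imports "HOL-Algebra.Algebra"
begin

text \<open>Powers of ideals are taken in the commutative monoid \<^const>\<open>ideals_set\<close> of all ideals of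
  the ring under the ideal product; the zeroth power is the unit ideal.\<close>

abbreviation ideal_pow :: "('a, 'b) ring_scheme \<Rightarrow> 'a set \<Rightarrow> nat \<Rightarrow> 'a set"
  where "ideal_pow R I n \<equiv> I [^]\<^bsub>ideals_set R\<^esub> n"

definition property_P :: "('a, 'b) ring_scheme \<Rightarrow> bool"
  where "property_P R \<longleftrightarrow>
    (\<forall>I J. ideal I R \<and> ideal J R \<and> I \<subset> J \<longrightarrow>
      (\<forall>n\<ge>1. ideal_pow R I n \<subset> ideal_pow R J n))"

definition ideal_colon :: "('a, 'b) ring_scheme \<Rightarrow> 'a set \<Rightarrow> 'a set \<Rightarrow> 'a set"
  where "ideal_colon R A B = {r \<in> carrier R. \<forall>b\<in>B. r \<otimes>\<^bsub>R\<^esub> b \<in> A}"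

definition ratliff_rush :: "('a, 'b) ring_scheme \<Rightarrow> 'a set \<Rightarrow> 'a set"
  where "ratliff_rush R I =
    (\<Union>m\<in>{1..}. ideal_colon R (ideal_pow R I (m + 1)) (ideal_pow R I m))"

text \<open>An element \<open>r\<close> is integral over \<open>I\<close> if
  \<open>r^n + a_1 r^(n-1) + \<dots> + a_n = 0\<close> for some \<open>n \<ge> 1\<close> and \<open>a_i\<close> in the \<open>i\<close>-th power of \<open>I\<close>
  (not merely in \<open>I\<close>).\<close>

definition integral_over_ideal :: "('a, 'b) ring_scheme \<Rightarrow> 'a set \<Rightarrow> 'a \<Rightarrow> bool"
  where "integral_over_ideal R I r \<longleftrightarrow>
    (\<exists>n\<ge>1. \<exists>a :: nat \<Rightarrow> 'a. (\<forall>i\<in>{1..n}. a i \<in> ideal_pow R I i) \<and>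
      r [^]\<^bsub>R\<^esub> n \<oplus>\<^bsub>R\<^esub> (\<Oplus>\<^bsub>R\<^esub>i\<in>{1..n}. a i \<otimes>\<^bsub>R\<^esub> r [^]\<^bsub>R\<^esub> (n - i)) = \<zero>\<^bsub>R\<^esub>)"

definition ideal_integral_closure :: "('a, 'b) ring_scheme \<Rightarrow> 'a set \<Rightarrow> 'a set"
  where "ideal_integral_closure R I = {r \<in> carrier R. integral_over_ideal R I r}"

definition integrally_closed_ideal :: "('a, 'b) ring_scheme \<Rightarrow> 'a set \<Rightarrow> bool"
  where "integrally_closed_ideal R I \<longleftrightarrow> ideal_integral_closure R I = I"

end

theory Submission
  imports Defs
begin

text \<open>If \<open>I \<subseteq> J\<close> and \<open>I\<^sup>n = J\<^sup>n\<close>, then \<open>J\<^sup>n = J\<^sup>n\<^sup>-\<^sup>1 I\<close>, so \<open>J I\<^sup>n = J\<^sup>n I = I\<^sup>n\<^sup>+\<^sup>1\<close> and \<open>J\<close> lies in the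
  Ratliff-Rush closure of \<open>I\<close>; moreover \<open>r\<^sup>n \<in> I\<^sup>n\<close> for \<open>r \<in> J\<close>, so \<open>J\<close> is integral over \<open>I\<close>.
  Conversely, let \<open>r I\<^sup>m \<subseteq> I\<^sup>m\<^sup>+\<^sup>1\<close> and \<open>J = (r) + I\<close>.  As \<open>I\<^sup>m\<close> is finitely generated and nonzero, the
  determinant trick gives \<open>r\<^sup>e\<^sup>+\<^sup>1 \<in> J\<^sup>e I\<close>, hence \<open>J\<^sup>e\<^sup>+\<^sup>1 = J\<^sup>e I\<close>, and therefore
  \<open>J\<^sup>e\<^sup>+\<^sup>m = J\<^sup>e I\<^sup>m \<subseteq> I\<^sup>e\<^sup>+\<^sup>m\<close>, although \<open>I \<noteq> J\<close> if \<open>r \<notin> I\<close>.\<close>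

section \<open>Powers and products of ideals\<close>

lemma ideals_set_simps [simp]:
  "carrier (ideals_set R) = {I. ideal I R}"
  "I \<otimes>\<^bsub>ideals_set R\<^esub> J = I \<cdot>\<^bsub>R\<^esub> J"
  "\<one>\<^bsub>ideals_set R\<^esub> = carrier R"
  by (simp_all add: ideals_set_def)

lemma ideal_prod_mono:
  assumes "I \<subseteq> I'" "J \<subseteq> J'"
  shows "I \<cdot>\<^bsub>R\<^esub> J \<subseteq> I' \<cdot>\<^bsub>R\<^esub> J'"
proof
  fix x assume "x \<in> I \<cdot>\<^bsub>R\<^esub> J"
  then show "x \<in> I' \<cdot>\<^bsub>R\<^esub> J'"
    by induct (use assms in \<open>auto intro: ideal_prod.intros\<close>)
qed

lemma ideal_pow_mono: "I \<subseteq> J \<Longrightarrow> ideal_pow R I n \<subseteq> ideal_pow R J n"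
  by (induct n) (auto dest: ideal_prod_mono)

lemma ideal_prod_leI:
  assumes "ideal K R" "\<And>i j. \<lbrakk>i \<in> I; j \<in> J\<rbrakk> \<Longrightarrow> i \<otimes>\<^bsub>R\<^esub> j \<in> K"
  shows "I \<cdot>\<^bsub>R\<^esub> J \<subseteq> K"
proof
  interpret ideal K R by fact
  fix x assume "x \<in> I \<cdot>\<^bsub>R\<^esub> J"
  then show "x \<in> K" by induct (auto intro: assms(2))
qed

context cring
begin

interpretation ideals: comm_monoid "ideals_set R"
  by (rule ideals_set_is_comm_monoid)

lemma ideal_ideal_pow [simp]: "ideal I R \<Longrightarrow> ideal (ideal_pow R I n) R"
  using ideals.nat_pow_closed by simp

lemma ideal_pow_add:
  "ideal I R \<Longrightarrow> ideal_pow R I m \<cdot> ideal_pow R I n = ideal_pow R I (m + n)"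
  using ideals.nat_pow_mult by simp

lemma ideal_pow_1: "ideal I R \<Longrightarrow> ideal_pow R I (Suc 0) = I"
  using ideals.l_one by simp

lemma pow_mem_ideal_pow: "\<lbrakk>ideal I R; r \<in> I\<rbrakk> \<Longrightarrow> r [^] n \<in> ideal_pow R I n"
  by (induct n) (auto intro: ideal_prod.prod)

text \<open>Sums of multiples of \<open>s\<close> collect into one multiple by distributivity. This
  supplies the single coefficient of \<open>s\<close> in the elimination below.\<close>

lemma mem_ideal_prod_cgenideal:
  assumes "ideal A R" "s \<in> carrier R" "x \<in> A \<cdot> (PIdl s)"
  obtains a where "a \<in> A" "x = a \<otimes> s"
proof -
  interpret A: ideal A R by fact
  from assms(3) have "\<exists>a\<in>A. x = a \<otimes> s"
  proof induct
    case (prod i j)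
    then obtain c where "c \<in> carrier R" "j = c \<otimes> s"
      by (auto simp: cgenideal_def)
    then show ?case
      using prod assms by (intro bexI[of _ "i \<otimes> c"]) (auto simp: m_assoc A.I_r_closed)
  next
    case (sum s1 s2)
    then show ?case
      using assms A.a_closed by (metis A.Icarr l_distr)
  qed
  then show ?thesis using that by blast
qed

lemma mem_cgenideal_add:
  assumes "x \<in> PIdl s <+>\<^bsub>R\<^esub> N"
  obtains p y where "p \<in> carrier R" "y \<in> N" "x = p \<otimes> s \<oplus> y"
proof -
  obtain h y where "h \<in> PIdl s" "y \<in> N" "x = h \<oplus> y"
    using assms unfolding set_add_def' by blast
  then show ?thesis
    using that by (auto simp: cgenideal_def)
qed

lemma cgenideal_addI:
  "\<lbrakk>p \<in> carrier R; y \<in> N\<rbrakk> \<Longrightarrow> p \<otimes> s \<oplus> y \<in> PIdl s <+>\<^bsub>R\<^esub> N"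
  unfolding set_add_def' cgenideal_def by auto

text \<open>Splits one generator off a finite generating set, as the induction in
  \<open>monic_values_annihilates\<close> requires.\<close>

lemma genideal_insert:
  assumes "s \<in> carrier R" "S \<subseteq> carrier R"
  shows "Idl (insert s S) = PIdl s <+> Idl S"
proof
  have c: "ideal (PIdl s) R" "ideal (Idl S) R"
    using assms by (auto intro: cgenideal_ideal genideal_ideal)
  have "PIdl s \<union> Idl S \<subseteq> PIdl s <+> Idl S"
    unfolding union_genideal[OF c, symmetric]
    using c by (intro genideal_self) (auto dest: ideal.Icarr)
  then show "Idl (insert s S) \<subseteq> PIdl s <+> Idl S"
    using assms(1) genideal_self[OF assms(2)] cgenideal_self c
    by (intro genideal_minimal add_ideals) auto
  have I: "ideal (Idl (insert s S)) R"
    using assms by (auto intro: genideal_ideal)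
  have "insert s S \<subseteq> Idl (insert s S)"
    using assms by (intro genideal_self) auto
  then show "PIdl s <+> Idl S \<subseteq> Idl (insert s S)"
    unfolding union_genideal[OF c, symmetric]
    by (intro genideal_minimal I Un_least cgenideal_minimal) auto
qed

section \<open>Integral dependence from a finitely generated module\<close>

text \<open>For \<open>J = (r) + I\<close> these are the values at \<open>r\<close> of the monic polynomials of degree \<open>d + 1\<close>
  whose \<open>i\<close>-th coefficient below the leading one lies in the \<open>i\<close>-th power of \<open>I\<close>.\<close>

definition monic_values :: "'a set \<Rightarrow> 'a set \<Rightarrow> 'a \<Rightarrow> nat \<Rightarrow> 'a set"
  where "monic_values I J r d = {r [^] Suc d \<oplus> a | a. a \<in> ideal_pow R J d \<cdot> I}"

lemma ideal_pow_prod_mult: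
  assumes "ideal I R" "ideal J R"
    and "x \<in> ideal_pow R J (Suc d)" "y \<in> ideal_pow R J e \<cdot> I"
  shows "x \<otimes> y \<in> ideal_pow R J (Suc (d + e)) \<cdot> I"
proof -
  have "x \<otimes> y \<in> ideal_pow R J (Suc d) \<cdot> (ideal_pow R J e \<cdot> I)"
    using assms by (blast intro: ideal_prod.prod)
  also have "\<dots> = ideal_pow R J (Suc d + e) \<cdot> I"
    using assms by (metis ideal_prod_assoc ideal_pow_add ideal_ideal_pow)
  finally show ?thesis by simp
qed

lemma ideal_pow_prod_le: "I \<subseteq> J \<Longrightarrow> ideal_pow R J d \<cdot> I \<subseteq> ideal_pow R J (Suc d)"
  using ideal_prod_mono[OF order_refl] by simp

lemma monic_values_le:
  assumes "ideal I R" "ideal J R" "I \<subseteq> J" "r \<in> J"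
  shows "monic_values I J r d \<subseteq> ideal_pow R J (Suc d)"
proof -
  interpret J': ideal "ideal_pow R J (Suc d)" R
    using assms by (intro ideal_ideal_pow)
  have "r [^] Suc d \<oplus> a \<in> ideal_pow R J (Suc d)" if "a \<in> ideal_pow R J d \<cdot> I" for a
    using that ideal_pow_prod_le[OF assms(3)] pow_mem_ideal_pow[OF assms(2,4)]
    by (intro J'.a_closed) blast+
  then show ?thesis unfolding monic_values_def by blast
qed

text \<open>The degrees add as \<open>(d + 1) + (e + 1) = (d + e + 1) + 1\<close>. Besides the
  leading power, the product leaves \<open>r^(d+1) b + v a\<close>, and each summand pairs an
  element of a power of \<open>J\<close> with one of some \<open>J^k I\<close>.\<close>

lemma monic_values_mult:
  assumes IJ: "ideal I R" "ideal J R" "I \<subseteq> J" "r \<in> J"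
    and u: "u \<in> monic_values I J r d" and v: "v \<in> monic_values I J r e"
  shows "u \<otimes> v \<in> monic_values I J r (Suc (d + e))"
proof -
  interpret J: ideal J R by fact
  have r: "r \<in> carrier R" using IJ J.Icarr by blast
  have K: "ideal (ideal_pow R J n \<cdot> I) R" for n
    using IJ by (intro ideal_prod_is_ideal ideal_ideal_pow)
  interpret K': ideal "ideal_pow R J (Suc (d + e)) \<cdot> I" R by (rule K)
  obtain a where a: "a \<in> ideal_pow R J d \<cdot> I" "u = r [^] Suc d \<oplus> a"
    using u by (auto simp: monic_values_def)
  obtain b where b: "b \<in> ideal_pow R J e \<cdot> I" "v = r [^] Suc e \<oplus> b"
    using v by (auto simp: monic_values_def)
  have ab: "a \<in> carrier R" "b \<in> carrier R"
    using a b ideal.Icarr[OF K] by blast+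
  have vc: "v \<in> ideal_pow R J (Suc e)"
    using monic_values_le[OF IJ] v by blast
  have v': "v \<in> carrier R" using b ab r by auto
  have 1: "r [^] Suc d \<otimes> b \<in> ideal_pow R J (Suc (d + e)) \<cdot> I"
    by (intro ideal_pow_prod_mult IJ pow_mem_ideal_pow b)
  have 2: "v \<otimes> a \<in> ideal_pow R J (Suc (e + d)) \<cdot> I"
    by (intro ideal_pow_prod_mult IJ vc a)
  have "u \<otimes> v = r [^] Suc d \<otimes> (r [^] Suc e \<oplus> b) \<oplus> v \<otimes> a"
    using a(2) b(2) ab r v' by (metis l_distr m_comm nat_pow_closed)
  also have "\<dots> = r [^] (Suc d + Suc e) \<oplus> (r [^] Suc d \<otimes> b \<oplus> v \<otimes> a)"
    using r ab v' nat_pow_mult[OF r, of "Suc d" "Suc e"]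
    by (simp add: r_distr a_assoc del: nat_pow_Suc Group.nat_pow_Suc)
  finally show ?thesis
    using K'.a_closed[OF 1] 2 unfolding monic_values_def by (auto simp: add.commute)
qed

text \<open>The determinant trick, carried out as an elimination of one generator at a time.  If
  \<open>u\<close> maps the module on \<open>s, S\<close> into its multiple by \<open>A = J\<^sup>d I\<close>, then \<open>u s = c s + n\<close> with
  \<open>c \<in> A\<close> and \<open>n \<in> A (S)\<close>; thus \<open>u - c\<close> takes \<open>s\<close> into \<open>A (S)\<close>, and \<open>(u - c) u\<close> acts on \<open>(S)\<close>.\<close>

lemma monic_values_annihilates:
  assumes "finite S" "S \<subseteq> carrier R"
    and IJ: "ideal I R" "ideal J R" "I \<subseteq> J" "r \<in> J"
    and "u \<in> monic_values I J r d"
    and "\<And>x. x \<in> Idl S \<Longrightarrow> u \<otimes> x \<in> (ideal_pow R J d \<cdot> I) \<cdot> (Idl S)"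
  shows "\<exists>e. \<exists>v\<in>monic_values I J r e. \<forall>x\<in>Idl S. v \<otimes> x = \<zero>"
  using assms(1,2,7,8)
proof (induction S arbitrary: u d rule: finite_induct)
  case empty
  \<comment> \<open>Without generators the module is zero, so \<open>u\<close> itself annihilates
    it.\<close>
  have "Idl {} = {\<zero>}"
    using genideal_minimal[OF zeroideal, of "{}"] genideal_ideal[of "{}"]
    by (auto intro: additive_subgroup.zero_closed ideal.axioms)
  moreover have "u \<in> carrier R"
    using monic_values_le[OF IJ] empty(2) ideal.Icarr[OF ideal_ideal_pow[OF IJ(2)]] by blast
  ultimately show ?case using empty(2) by fastforce
next
  case (insert s S)
  interpret J: ideal J R by fact
  define A where "A = ideal_pow R J d \<cdot> I"
  define N where "N = Idl S"
  \<comment> \<open>Two monic values of index \<open>d\<close> multiply to one of index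
    \<open>Suc (d + d)\<close>, and \<open>K\<close> is the coefficient ideal of that index. The
    induction hypothesis therefore asks for values in \<open>K N\<close>.\<close>
  define K where "K = ideal_pow R J (Suc (d + d)) \<cdot> I"
  have r: "r \<in> carrier R" using IJ J.Icarr by blast
  have s: "s \<in> carrier R" and S: "S \<subseteq> carrier R" using insert.prems by auto
  interpret A: ideal A R
    unfolding A_def using IJ by (intro ideal_prod_is_ideal ideal_ideal_pow)
  interpret N: ideal N R
    unfolding N_def using S by (rule genideal_ideal)
  interpret K: ideal K R
    unfolding K_def using IJ by (intro ideal_prod_is_ideal ideal_ideal_pow)
  interpret KN: ideal "K \<cdot> N" R
    by (intro ideal_prod_is_ideal K.is_ideal N.is_ideal)
  interpret AN: ideal "A \<cdot> N" R
    by (intro ideal_prod_is_ideal A.is_ideal N.is_ideal)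
  have PI: "ideal (PIdl s) R" using s by (rule cgenideal_ideal)
  have gen: "Idl (insert s S) = PIdl s <+> N"
    unfolding N_def using s S by (rule genideal_insert)
  have sIdl: "s \<in> Idl (insert s S)" and NIdl: "N \<subseteq> Idl (insert s S)"
    using genideal_self[of "insert s S"] subset_Idl_subset[of "insert s S" S] s S
    unfolding N_def by auto
  have decomp: "\<exists>c\<in>A. \<exists>n\<in>A \<cdot> N. u \<otimes> x = c \<otimes> s \<oplus> n" if x: "x \<in> Idl (insert s S)" for x
  proof -
    have "u \<otimes> x \<in> A \<cdot> (PIdl s <+> N)"
      using insert.prems(3)[OF x] unfolding gen A_def .
    also have "\<dots> = A \<cdot> (PIdl s) <+> A \<cdot> N"
      by (intro ideal_prod_r_distr A.is_ideal N.is_ideal PI)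
    finally obtain p n where "p \<in> A \<cdot> (PIdl s)" "n \<in> A \<cdot> N" "u \<otimes> x = p \<oplus> n"
      by (auto simp: set_add_def')
    then show ?thesis
      by (metis mem_ideal_prod_cgenideal[OF A.is_ideal s])
  qed
  obtain a where a: "a \<in> A" "u = r [^] Suc d \<oplus> a"
    using insert.prems(2) by (auto simp: monic_values_def A_def)
  have u: "u \<in> carrier R" using a r A.Icarr by auto
  obtain c n where c: "c \<in> A" and n: "n \<in> A \<cdot> N" and us: "u \<otimes> s = c \<otimes> s \<oplus> n"
    using decomp[OF sIdl] by blast
  have cc: "c \<in> carrier R" "a \<in> carrier R" "n \<in> carrier R"
    using c a n A.Icarr AN.Icarr by auto
  define w where "w = u \<ominus> c"
  have w: "w \<in> carrier R" using u cc by (simp add: w_def)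
  \<comment> \<open>Subtracting an element of \<open>A\<close> alters only the lower-order part, so
    \<open>w\<close> has the same index \<open>d\<close> as \<open>u\<close>.\<close>
  have "w = r [^] Suc d \<oplus> (a \<ominus> c)"
    unfolding w_def a(2) using cc r by (simp add: a_minus_def a_assoc)
  moreover have "a \<ominus> c \<in> A"
    using a c by (simp add: a_minus_def)
  ultimately have wm: "w \<in> monic_values I J r d"
    by (auto simp: monic_values_def A_def)
  have "w \<otimes> s = u \<otimes> s \<ominus> c \<otimes> s"
    unfolding w_def using u cc s by (simp add: a_minus_def l_distr l_minus)
  also have "\<dots> = n"
    unfolding us using cc s by (simp add: a_minus_def a_comm[of "c \<otimes> s" n] a_assoc r_neg)
  finally have ws: "w \<otimes> s = n" .
  have wJ: "w \<in> ideal_pow R J (Suc d)"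
    using monic_values_le[OF IJ] wm by blast
  have AJ: "A \<subseteq> ideal_pow R J (Suc d)"
    unfolding A_def using IJ by (intro ideal_pow_prod_le)
  \<comment> \<open>The product of \<open>J^(d+1)\<close> and \<open>A = J^d I\<close> lies in
    \<open>K\<close>. This serves both \<open>w\<close> and the coefficients from \<open>A\<close>,
    which also lie in \<open>J^(d+1)\<close>.\<close>
  have JAN: "y \<otimes> z \<in> K \<cdot> N" if y: "y \<in> ideal_pow R J (Suc d)" and z: "z \<in> A \<cdot> N" for y z
  proof -
    have yc: "y \<in> carrier R"
      using y ideal.Icarr[OF ideal_ideal_pow[OF IJ(2)]] by blast
    show ?thesis
      using z
    proof induct
      case (prod i j)
      have "y \<otimes> i \<in> K"
        unfolding K_def using ideal_pow_prod_mult[OF IJ(1,2) y] prod by (simp add: A_def)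
      then have "(y \<otimes> i) \<otimes> j \<in> K \<cdot> N" using prod by (intro ideal_prod.prod)
      then show ?case using yc prod A.Icarr N.Icarr by (simp add: m_assoc)
    next
      case (sum s1 s2)
      then show ?case using yc AN.Icarr by (simp add: r_distr)
    qed
  qed
  have step: "(w \<otimes> u) \<otimes> x \<in> K \<cdot> N" if x: "x \<in> N" for x
  proof -
    obtain c' n' where c': "c' \<in> A" and n': "n' \<in> A \<cdot> N" and ux: "u \<otimes> x = c' \<otimes> s \<oplus> n'"
      using decomp x NIdl by blast
    have cc': "c' \<in> carrier R" "n' \<in> carrier R" "x \<in> carrier R"
      using c' n' x A.Icarr AN.Icarr N.Icarr by auto
    have "(w \<otimes> u) \<otimes> x = w \<otimes> (c' \<otimes> s \<oplus> n')"
      using w u cc' by (simp add: m_assoc ux)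
    \<comment> \<open>As \<open>w s = n\<close>, the generator \<open>s\<close> disappears.\<close>
    also have "\<dots> = c' \<otimes> n \<oplus> w \<otimes> n'"
      using w s cc' by (simp add: r_distr m_lcomm ws[symmetric])
    also have "\<dots> \<in> K \<cdot> N"
      using JAN c' n AJ wJ n' by (intro KN.a_closed) auto
    finally show ?thesis .
  qed
  obtain e v where vm: "v \<in> monic_values I J r e" and v0: "\<And>x. x \<in> N \<Longrightarrow> v \<otimes> x = \<zero>"
    using insert.IH[OF S monic_values_mult[OF IJ wm insert.prems(2)]] step
    unfolding K_def N_def by blast
  have vc: "v \<in> carrier R"
    using monic_values_le[OF IJ] vm ideal.Icarr[OF ideal_ideal_pow[OF IJ(2)]] by blast
  have nN: "n \<in> N"
    using n ideal_prod_inter[OF A.is_ideal N.is_ideal] by blast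
  \<comment> \<open>\<open>v\<close> kills \<open>N\<close>, and \<open>w\<close> carries
    \<open>s\<close> to \<open>n\<close> in \<open>N\<close>; hence \<open>v w\<close> kills both
    \<open>s\<close> and \<open>N\<close>.\<close>
  have "(v \<otimes> w) \<otimes> x = \<zero>" if x: "x \<in> Idl (insert s S)" for x
  proof -
    obtain p y where p: "p \<in> carrier R" and y: "y \<in> N" and xeq: "x = p \<otimes> s \<oplus> y"
      using x unfolding gen by (rule mem_cgenideal_add)
    have yc: "y \<in> carrier R" using y N.Icarr by blast
    have "(v \<otimes> w) \<otimes> x = p \<otimes> (v \<otimes> (w \<otimes> s)) \<oplus> w \<otimes> (v \<otimes> y)"
      unfolding xeq using p s yc vc w by (simp add: r_distr m_ac)
    then show ?thesis
      using v0[OF y] v0[OF nN] p w by (simp add: ws)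
  qed
  then show ?case
    using monic_values_mult[OF IJ vm wm] by blast
qed


section \<open>Reductions\<close>

text \<open>In the expansion of the power, only the pure power of \<open>r\<close> has no factor
  from \<open>I\<close>. Every other term has one, and its \<open>n\<close> remaining factors lie in
  \<open>J\<close>.\<close>

lemma ideal_pow_adjoin_le:
  fixes I J :: "'a set"
  assumes I: "ideal I R" and r: "r \<in> carrier R" and J: "J = PIdl r <+> I"
  shows "ideal_pow R J (Suc n) \<subseteq> PIdl (r [^] Suc n) <+> ideal_pow R J n \<cdot> I"
proof (induction n)
  case 0
  have "ideal J R"
    unfolding J by (intro add_ideals cgenideal_ideal I r)
  then show ?case
    using I r ideal_pow_1[of J] ideals.l_one[of I] by (simp add: J)
next
  case (Suc n)
  have PI: "ideal (PIdl r) R" by (intro cgenideal_ideal r)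
  have Ji: "ideal J R"
    unfolding J by (intro add_ideals PI I)
  have IJ: "I \<subseteq> J"
    unfolding J union_genideal[OF PI I, symmetric]
    using genideal_self[of "PIdl r \<union> I"] PI I by (auto dest: ideal.Icarr)
  have rJ: "r \<in> J"
    unfolding J union_genideal[OF PI I, symmetric]
    using genideal_self[of "PIdl r \<union> I"] cgenideal_self[OF r] PI I by (auto dest: ideal.Icarr)
  interpret I: ideal I R by fact
  interpret J: ideal J R by fact
  define K where "K = ideal_pow R J (Suc n) \<cdot> I"
  interpret K: ideal K R
    unfolding K_def by (intro ideal_prod_is_ideal ideal_ideal_pow Ji I)
  have Kn: "ideal (ideal_pow R J n \<cdot> I) R"
    by (intro ideal_prod_is_ideal ideal_ideal_pow Ji I)
  have "ideal_pow R J (Suc n) \<cdot> J \<subseteq> PIdl (r [^] Suc (Suc n)) <+> K"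
  proof (rule ideal_prod_leI)
    show "ideal (PIdl (r [^] Suc (Suc n)) <+> K) R"
      by (intro add_ideals cgenideal_ideal K.is_ideal nat_pow_closed r)
  next
    fix x y assume "x \<in> ideal_pow R J (Suc n)" "y \<in> J"
    obtain c k where c: "c \<in> carrier R" and k: "k \<in> ideal_pow R J n \<cdot> I"
      and x: "x = c \<otimes> r [^] Suc n \<oplus> k"
      using Suc \<open>x \<in> _\<close> by (blast elim: mem_cgenideal_add)
    obtain c' i where c': "c' \<in> carrier R" and i: "i \<in> I" and y: "y = c' \<otimes> r \<oplus> i"
      using \<open>y \<in> J\<close> unfolding J by (blast elim: mem_cgenideal_add)
    have carr: "k \<in> carrier R" "i \<in> carrier R" "y \<in> carrier R"
      using ideal.Icarr[OF Kn k] i \<open>y \<in> J\<close> by auto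
    have ry: "r [^] Suc n \<otimes> i \<in> K"
      unfolding K_def by (intro ideal_prod.prod pow_mem_ideal_pow Ji rJ i)
    have yk: "y \<otimes> k \<in> K"
      using ideal_pow_prod_mult[OF I Ji _ k, of y 0] \<open>y \<in> J\<close> ideal_pow_1[OF Ji]
      by (simp add: K_def)
    \<comment> \<open>Multiplying out leaves one multiple of the next power of \<open>r\<close>. The
      mixed terms \<open>r^(n+1) i\<close> and \<open>y k\<close> lie in \<open>K\<close>; in the
      latter \<open>y\<close> stays unexpanded.\<close>
    have "x \<otimes> y = c \<otimes> r [^] Suc n \<otimes> y \<oplus> y \<otimes> k"
      unfolding x using c r carr by (simp add: l_distr m_comm[of k y])
    also have "c \<otimes> r [^] Suc n \<otimes> y = c \<otimes> r [^] Suc n \<otimes> (c' \<otimes> r) \<oplus> c \<otimes> r [^] Suc n \<otimes> i"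
      unfolding y using c c' r carr by (intro r_distr) auto
    also have "c \<otimes> r [^] Suc n \<otimes> (c' \<otimes> r) = (c \<otimes> c') \<otimes> r [^] Suc (Suc n)"
      using c c' r by (simp add: m_ac)
    also have "c \<otimes> r [^] Suc n \<otimes> i = c \<otimes> (r [^] Suc n \<otimes> i)"
      using c r carr by (intro m_assoc) auto
    finally have "x \<otimes> y = (c \<otimes> c') \<otimes> r [^] Suc (Suc n) \<oplus> (c \<otimes> (r [^] Suc n \<otimes> i) \<oplus> y \<otimes> k)"
      using c c' r carr ideal.Icarr[OF Kn k] by (simp add: a_assoc)
    moreover have "c \<otimes> (r [^] Suc n \<otimes> i) \<oplus> y \<otimes> k \<in> K"
      using K.I_l_closed[OF ry c] yk by blast
    ultimately show "x \<otimes> y \<in> PIdl (r [^] Suc (Suc n)) <+> K"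
      using c c' by (simp only: cgenideal_addI m_closed)
  qed
  then show ?case by (simp add: K_def)
qed

text \<open>The hypothesis is the equation of a reduction: next to \<open>J^e\<close>, each further
  factor \<open>J\<close> can be exchanged for \<open>I\<close>, one at a time.\<close>

lemma ideal_pow_reduction:
  assumes "ideal I R" "ideal J R" "ideal_pow R J (Suc e) = ideal_pow R J e \<cdot> I"
  shows "ideal_pow R J (e + k) = ideal_pow R J e \<cdot> ideal_pow R I k"
proof (induction k)
  case 0
  then show ?case using assms ideals.r_one[of "ideal_pow R J e"] by simp
next
  case (Suc k)
  have "ideal_pow R J (e + Suc k) = (ideal_pow R J e \<cdot> ideal_pow R I k) \<cdot> J"
    using Suc by simp
  also have "\<dots> = ideal_pow R J (Suc e) \<cdot> ideal_pow R I k"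
    using assms(1,2) by (simp add: ideal_prod_assoc ideal_prod_commute[of "ideal_pow R I k" J])
  also have "\<dots> = ideal_pow R J e \<cdot> ideal_pow R I (Suc k)"
    unfolding assms(3) using assms(1,2)
    by (simp add: ideal_prod_assoc ideal_prod_commute[of I "ideal_pow R I k"])
  finally show ?case .
qed

text \<open>Each factor \<open>J\<close> is traded for a factor \<open>I\<close>, while
  \<open>I^m\<close> survives to absorb the next one.\<close>

lemma ideal_pow_absorb:
  assumes "ideal I R" "ideal J R" "J \<cdot> ideal_pow R I m \<subseteq> ideal_pow R I (Suc m)"
  shows "ideal_pow R J k \<cdot> ideal_pow R I m \<subseteq> ideal_pow R I (k + m)"
proof (induction k)
  case 0
  then show ?case using assms ideals.l_one[of "ideal_pow R I m"] by simp
next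
  case (Suc k)
  have "ideal_pow R J (Suc k) \<cdot> ideal_pow R I m = ideal_pow R J k \<cdot> (J \<cdot> ideal_pow R I m)"
    using assms(1,2) by (simp add: ideal_prod_assoc)
  also have "\<dots> \<subseteq> ideal_pow R J k \<cdot> (ideal_pow R I m \<cdot> I)"
    using assms(3) by (intro ideal_prod_mono[OF order_refl]) simp
  also have "\<dots> = ideal_pow R J k \<cdot> ideal_pow R I m \<cdot> I"
    using assms(1,2) by (simp add: ideal_prod_assoc)
  also have "\<dots> \<subseteq> ideal_pow R I (Suc k + m)"
    using Suc by (auto dest: ideal_prod_mono)
  finally show ?case .
qed

section \<open>Membership in the Ratliff-Rush and integral closures\<close>

lemma ideal_le_ratliff_rush:
  assumes "ideal I R"
  shows "I \<subseteq> ratliff_rush R I"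
proof -
  interpret ideal I R by fact
  \<comment> \<open>The member \<open>m = 1\<close> of the union suffices.\<close>
  have "x \<otimes> b \<in> ideal_pow R I (Suc 0 + 1)" if "x \<in> I" "b \<in> ideal_pow R I (Suc 0)" for x b
    using that ideal_pow_1[OF assms] by (auto intro: ideal_prod.prod)
  then show ?thesis
    unfolding ratliff_rush_def ideal_colon_def by force
qed

lemma ratliff_rush_if_ideal_pow_eq:
  assumes I: "ideal I R" and J: "ideal J R" "I \<subseteq> J" and n: "n \<ge> 1"
    and eq: "ideal_pow R I n = ideal_pow R J n"
  shows "J \<subseteq> ratliff_rush R I"
proof -
  obtain p where p: "n = Suc p" using n by (cases n) auto
  \<comment> \<open>One of the \<open>n\<close> factors \<open>I\<close> is kept and the other
    \<open>p\<close> are enlarged to \<open>J\<close>.\<close>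
  have "ideal_pow R J n \<subseteq> ideal_pow R J p \<cdot> I"
    unfolding eq[symmetric] unfolding p
    using ideal_prod_mono[OF ideal_pow_mono[OF J(2)] order_refl] by simp
  then have "J \<cdot> ideal_pow R J n \<subseteq> J \<cdot> (ideal_pow R J p \<cdot> I)"
    by (rule ideal_prod_mono[OF order_refl])
  also have "\<dots> = ideal_pow R J n \<cdot> I"
    using I J by (simp add: p ideal_prod_assoc[symmetric] ideal_prod_commute[of J])
  also have "\<dots> = ideal_pow R I (n + 1)"
    by (simp add: eq)
  finally have "J \<cdot> ideal_pow R I n \<subseteq> ideal_pow R I (n + 1)"
    unfolding eq .
  then show ?thesis
    using n ideal.Icarr[OF J(1)] unfolding ratliff_rush_def ideal_colon_def
    by (blast intro: ideal_prod.prod)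
qed

text \<open>The equation is \<open>r^n - r^n = 0\<close>: every coefficient but the last,
  \<open>- r^n\<close> in \<open>I^n\<close>, is zero.\<close>

lemma integral_over_ideal_if_pow_mem:
  assumes I: "ideal I R" and r: "r \<in> carrier R" and n: "n \<ge> 1"
    and "r [^] n \<in> ideal_pow R I n"
  shows "integral_over_ideal R I r"
proof -
  define a where "a i = (if i = n then \<ominus> (r [^] n) else \<zero>)" for i
  have sub: "additive_subgroup (ideal_pow R I i) R" for i
    using I by (intro ideal.axioms ideal_ideal_pow)
  have "a i \<in> ideal_pow R I i" for i
    using assms(4) additive_subgroup.zero_closed[OF sub] additive_subgroup.a_inv_closed[OF sub]
    by (auto simp: a_def)
  moreover have "(\<Oplus>i\<in>{1..n}. a i \<otimes> r [^] (n - i)) =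
      (\<Oplus>i\<in>{1..n}. if n = i then \<ominus> (r [^] n) else \<zero>)"
    using r by (intro finsum_cong') (auto simp: a_def)
  then have "r [^] n \<oplus> (\<Oplus>i\<in>{1..n}. a i \<otimes> r [^] (n - i)) = \<zero>"
    using n r add.finprod_singleton[of n "{1..n}" "\<lambda>_. \<ominus> (r [^] n)"]
    by (simp add: r_neg finsum_def)
  ultimately show ?thesis
    unfolding integral_over_ideal_def using n by blast
qed

end

section \<open>From the Ratliff-Rush closure to equal powers in a Noetherian domain\<close>

context domain
begin

lemma ideal_pow_nonzero:
  assumes "ideal I R" "I \<noteq> {\<zero>}"
  shows "ideal_pow R I n \<noteq> {\<zero>}"
proof -
  interpret ideal I R by fact
  obtain x where "x \<in> I" "x \<noteq> \<zero>"
    using assms zero_closed by blast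
  moreover have "x [^] n \<noteq> \<zero>"
    using calculation Icarr by (induct n) (auto simp: integral_iff)
  ultimately show ?thesis
    using pow_mem_ideal_pow[OF assms(1)] by blast
qed

end

text \<open>Turns membership in the closure into equal powers of nested ideals, which property (P)
  permits only if \<open>r\<close> is already in \<open>I\<close>.\<close>

lemma (in noetherian_domain) ratliff_rush_reduction:
  assumes I: "ideal I R" "I \<noteq> {\<zero>}" and "r \<in> ratliff_rush R I"
  obtains J n where "ideal J R" "I \<subseteq> J" "r \<in> J" "n \<ge> 1" "ideal_pow R J n = ideal_pow R I n"
proof -
  obtain m where m: "m \<ge> 1" and r: "r \<in> carrier R"
    and rI: "\<And>x. x \<in> ideal_pow R I m \<Longrightarrow> r \<otimes> x \<in> ideal_pow R I (Suc m)"
    using assms(3) by (auto simp: ratliff_rush_def ideal_colon_def)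
  define J where "J = Idl (PIdl r \<union> I)"
  define M where "M = ideal_pow R I m"
  have PI: "ideal (PIdl r) R" by (intro cgenideal_ideal r)
  have sub: "PIdl r \<union> I \<subseteq> carrier R"
    using PI I by (auto dest: ideal.Icarr)
  have J: "ideal J R" unfolding J_def using sub by (rule genideal_ideal)
  have Jeq: "J = PIdl r <+> I" unfolding J_def by (rule union_genideal[OF PI I(1)])
  have IJ: "I \<subseteq> J" and rJ: "r \<in> J"
    using genideal_self[OF sub] cgenideal_self[OF r] by (auto simp: J_def)
  have Mi: "ideal M R" unfolding M_def using I by simp
  have Suc_m: "ideal_pow R I (Suc m) = I \<cdot> M"
    using I Mi by (simp add: M_def ideal_prod_commute)
  obtain S where S: "S \<subseteq> carrier R" "finite S" "M = Idl S"
    using finetely_gen[OF Mi] by blast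
  have pow0: "ideal_pow R J 0 \<cdot> I = I"
    using ideal_prod_commute[OF oneideal I(1)] ideal_prod_one[OF I(1)] by simp
  \<comment> \<open>\<open>r = r^1 + 0\<close> is a monic value of index 0.\<close>
  have "r \<in> monic_values I J r 0"
    unfolding monic_values_def pow0
    using r additive_subgroup.zero_closed[OF ideal.axioms(1)[OF I(1)]] by force
  moreover have "r \<otimes> x \<in> (ideal_pow R J 0 \<cdot> I) \<cdot> (Idl S)" if "x \<in> Idl S" for x
    using rI[of x] that unfolding pow0 Suc_m S(3)[symmetric] M_def[symmetric] .
  ultimately obtain e v where v: "v \<in> monic_values I J r e" "\<And>x. x \<in> M \<Longrightarrow> v \<otimes> x = \<zero>"
    using monic_values_annihilates[OF S(2,1) I(1) J IJ rJ] unfolding S(3) by blast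
  have Ke: "ideal (ideal_pow R J e \<cdot> I) R"
    using I J by (intro ideal_prod_is_ideal ideal_ideal_pow)
  obtain a where a: "a \<in> ideal_pow R J e \<cdot> I" "v = r [^] Suc e \<oplus> a"
    using v(1) by (auto simp: monic_values_def)
  have ac: "a \<in> carrier R" using a ideal.Icarr[OF Ke] by blast
  obtain x where x: "x \<in> M" "x \<noteq> \<zero>"
    using ideal_pow_nonzero[OF I] additive_subgroup.zero_closed[OF ideal.axioms(1)[OF Mi]]
    unfolding M_def by blast
  \<comment> \<open>In a domain, only zero annihilates the nonzero element \<open>x\<close> of
    \<open>M\<close>. The vanishing of \<open>v\<close> then places \<open>r^(e+1)\<close> in
    \<open>J^e I\<close>.\<close>
  have "v = \<zero>"
    using v(2)[OF x(1)] x ideal.Icarr[OF Mi x(1)] r ac a(2) integral_iff by auto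
  then have "r [^] Suc e = \<ominus> a"
    using a(2) ac r by (metis minus_equality a_comm nat_pow_closed)
  then have "r [^] Suc e \<in> ideal_pow R J e \<cdot> I"
    using a(1) additive_subgroup.a_inv_closed[OF ideal.axioms(1)[OF Ke]] by simp
  then have "PIdl (r [^] Suc e) \<union> ideal_pow R J e \<cdot> I \<subseteq> ideal_pow R J e \<cdot> I"
    using cgenideal_minimal[OF Ke] by blast
  then have "PIdl (r [^] Suc e) <+> ideal_pow R J e \<cdot> I \<subseteq> ideal_pow R J e \<cdot> I"
    using union_genideal[OF cgenideal_ideal Ke] genideal_minimal[OF Ke] r nat_pow_closed
    by metis
  then have Je: "ideal_pow R J (Suc e) = ideal_pow R J e \<cdot> I"
    using ideal_pow_adjoin_le[OF I(1) r Jeq, of e] ideal_pow_prod_le[OF IJ, of e] by blast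
  \<comment> \<open>\<open>r\<close> multiplies \<open>I^m\<close> into \<open>I^(m+1)\<close> by
    the choice of \<open>m\<close>, and so do the elements of \<open>I\<close>; hence all of
    \<open>J\<close> does.\<close>
  have "J \<cdot> M \<subseteq> ideal_pow R I (Suc m)"
  proof (rule ideal_prod_leI)
    show K: "ideal (ideal_pow R I (Suc m)) R" using I(1) by (rule ideal_ideal_pow)
    fix y x assume "y \<in> J" and x: "x \<in> M"
    then obtain c i where c: "c \<in> carrier R" and i: "i \<in> I" and y: "y = c \<otimes> r \<oplus> i"
      unfolding Jeq by (blast elim: mem_cgenideal_add)
    have xc: "x \<in> carrier R" "i \<in> carrier R"
      using x i ideal.Icarr Mi I by metis+
    have "y \<otimes> x = c \<otimes> (r \<otimes> x) \<oplus> i \<otimes> x"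
      unfolding y using c r xc by (simp add: l_distr m_assoc)
    moreover have "i \<otimes> x \<in> ideal_pow R I (Suc m)"
      unfolding Suc_m using i x by (rule ideal_prod.prod)
    moreover have "c \<otimes> (r \<otimes> x) \<in> ideal_pow R I (Suc m)"
      using ideal.I_l_closed[OF K rI c] x by (simp add: M_def)
    ultimately show "y \<otimes> x \<in> ideal_pow R I (Suc m)"
      using additive_subgroup.a_closed[OF ideal.axioms(1)[OF K]] by simp
  qed
  then have "ideal_pow R J (e + m) \<subseteq> ideal_pow R I (e + m)"
    unfolding ideal_pow_reduction[OF I(1) J Je] M_def by (rule ideal_pow_absorb[OF I(1) J])
  then have "ideal_pow R J (e + m) = ideal_pow R I (e + m)"
    using ideal_pow_mono[OF IJ] by blast
  \<comment> \<open>\<open>m \<ge> 1\<close> keeps the exponent \<open>e + m\<close> positive even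
    when \<open>e = 0\<close>.\<close>
  then show ?thesis
    using that[OF J IJ rJ, of "e + m"] m by simp
qed

theorem theorem14p2:
  fixes R :: "('a, 'b) ring_scheme"
  assumes "noetherian_domain R"
  shows "(property_P R \<longleftrightarrow>
            (\<forall>I. ideal I R \<and> I \<noteq> {\<zero>\<^bsub>R\<^esub>} \<longrightarrow> ratliff_rush R I = I)) \<and>
         ((\<forall>I. ideal I R \<longrightarrow> integrally_closed_ideal R I) \<longrightarrow> property_P R)"
proof (intro conjI iffI allI impI)
  interpret noetherian_domain R by fact
  {
    fix I assume P: "property_P R" and I: "ideal I R \<and> I \<noteq> {\<zero>\<^bsub>R\<^esub>}"
    have "r \<in> I" if "r \<in> ratliff_rush R I" for r
      using ratliff_rush_reduction[of I r] P I that unfolding property_P_def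
      by (metis psubset_eq psubsetI)
    then show "ratliff_rush R I = I"
      using ideal_le_ratliff_rush[of I] I by blast
  next
    assume RR: "\<forall>I. ideal I R \<and> I \<noteq> {\<zero>\<^bsub>R\<^esub>} \<longrightarrow> ratliff_rush R I = I"
    have "ideal_pow R I n \<noteq> ideal_pow R J n"
      if I: "ideal I R" and J: "ideal J R" "I \<subset> J" and n: "n \<ge> 1" for I J and n :: nat
    proof
      assume eq: "ideal_pow R I n = ideal_pow R J n"
      \<comment> \<open>The assumption \<open>RR\<close> speaks only of nonzero ideals. If
        \<open>I\<close> is zero, so is \<open>I^n\<close> because \<open>n \<ge> 1\<close>, whereas
        \<open>J^n\<close> is nonzero in a domain.\<close>
      have "I \<noteq> {\<zero>\<^bsub>R\<^esub>}"
      proof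
        assume I0: "I = {\<zero>\<^bsub>R\<^esub>}"
        have "ideal_pow R I n \<subseteq> {\<zero>\<^bsub>R\<^esub>}"
          using n ideal_prod_zero[OF ideal_ideal_pow[OF I]] by (cases n) (auto simp: I0)
        moreover have "\<zero>\<^bsub>R\<^esub> \<in> ideal_pow R I n"
          using I by (intro additive_subgroup.zero_closed ideal.axioms ideal_ideal_pow)
        ultimately show False
          using ideal_pow_nonzero[OF J(1), of n] J(2) eq I0 by blast
      qed
      then show False
        using ratliff_rush_if_ideal_pow_eq[OF I J(1) _ n eq] J RR I by blast
    qed
    then show "property_P R"
      unfolding property_P_def using ideal_pow_mono by (metis psubset_eq)
  next
    assume C: "\<forall>I. ideal I R \<longrightarrow> integrally_closed_ideal R I"
    \<comment> \<open>For \<open>r\<close> in \<open>J\<close>, equal powers give \<open>r^n\<close>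
      in \<open>I^n\<close>, so \<open>r\<close> is integral over \<open>I\<close> and lies in
      \<open>I\<close>. A strict inclusion of \<open>I\<close> in \<open>J\<close> is thus
      impossible.\<close>
    have "J \<subseteq> I"
      if I: "ideal I R" and J: "ideal J R" and n: "n \<ge> 1"
        and eq: "ideal_pow R I n = ideal_pow R J n" for I J and n :: nat
    proof
      fix r assume r: "r \<in> J"
      then have "r \<in> ideal_integral_closure R I"
        unfolding ideal_integral_closure_def
        using integral_over_ideal_if_pow_mem[OF I _ n] pow_mem_ideal_pow[OF J r]
          ideal.Icarr[OF J r] eq by auto
      then show "r \<in> I"
        using C I by (auto simp: integrally_closed_ideal_def)
    qed
    then show "property_P R"
      unfolding property_P_def using ideal_pow_mono by (metis psubset_eq subset_antisym)
  }
qed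

end
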